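(* Let $L\ge 2$ and let $M_l = U\Lambda_l U^\top + \epsilon R_l$, $l\in\{1,\dots,L\}$, be $d\times d$ matrices with common factors $U\in\mathbb{R}^{d\times k}$ (with orthonormal columns) and diagonal $\Lambda_l\in\mathbb{R}^{k\times k}$, where $\epsilon>0$ and each $R_l$ has unit norm. Let $\bar U\in\mathbb{R}^{d\times d}$ be a full-rank (orthogonal) extension of $U$ with columns $u_1,u_2,\dots,u_d$, and let $\tilde U\in\mathbb{R}^{d\times d}$ be the orthogonal minimizer of the joint diagonalization objective $F$. Then, for all $u_j$, $j\in\{1,\dots,k\}$, there exists a column $\tilde u_j$ of $\tilde U$ such that $$\|\tilde u_j-u_j\|_2\le \epsilon\sqrt{\sum_{i=1}^d E_{ij}^2}+o(\epsilon),$$ where $E\in\mathbb{R}^{d\times k}$ is given by $$E_{ij}=\frac{\sum_{l=1}^L(\lambda_{il}-\lambda_{jl})\,u_j^\top R_l u_i}{\sum_{l=1}^L(\lambda_{il}-\lambda_{jl})^2}$$ when $i\ne j$ and $i\le k$ or $j\le k$, and $E_{ij}=0$ when $i=j$. Here $\lambda_{il}=(\Lambda_l)_{ii}$ for $i\le k$, and $\lambda_{il}=0$ when $i>k$.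
   Context: The joint diagonalization objective for $M_1,\dots,M_L$ is $F(V)=\sum_{l=1}^L\sum_{i\ne j}\big((V^{-1}M_lV^{-\top})_{ij}\big)^2$; in the orthogonal case it is minimized over orthogonal $V\in\mathbb{R}^{d\times d}$, for which $V^{-1}=V^\top$. The columns of $U$ are $u_1,\dots,u_k$. The matrices $M_l$ are symmetric.
   Formalization: The bound is proved for a column of the minimizer up to sign (±ũ_j), since negating all columns of a minimizer gives another minimizer for which the literal claim fails; the denominators of E_ij (i≠j) are assumed nonzero so that E is defined; unit norm is read as spectral norm. *)

theory Defs
  imports "HOL-Analysis.Analysis" "HOL-Library.Landau_Symbols"
begin

definition joint_diag_objective ::
    "nat \<Rightarrow> (nat \<Rightarrow> real^'d^'d) \<Rightarrow> real^'d^'d \<Rightarrow> real" where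
  "joint_diag_objective L M V =
     (\<Sum>l=1..L. \<Sum>i\<in>UNIV. \<Sum>j\<in>UNIV - {i}.
        ((matrix_inv V ** M l ** transpose (matrix_inv V)) $ i $ j)\<^sup>2)"

text \<open>
  The objective does not change when columns of \<open>V\<close> are permuted or negated, so a minimizer is
  determined at best up to order and signs of its columns.
\<close>

definition orthogonal_minimizer ::
    "nat \<Rightarrow> (nat \<Rightarrow> real^'d^'d) \<Rightarrow> real^'d^'d \<Rightarrow> bool" where
  "orthogonal_minimizer L M V \<longleftrightarrow> is_arg_min (joint_diag_objective L M) orthogonal_matrix V"

text \<open>
  Matrix dimensions are index types, so the inclusion of \<open>{1,\<dots>,k}\<close> in \<open>{1,\<dots>,d}\<close> is given by an
  injection \<open>\<iota>\<close>: an index \<open>i\<close> with \<open>i \<le> k\<close> is one in \<open>range \<iota>\<close>, and \<open>i = j\<close> for \<open>j \<le> k\<close> reads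
  \<open>i = \<iota> j\<close>.
\<close>

definition factor_weight ::
    "('k \<Rightarrow> 'd) \<Rightarrow> (nat \<Rightarrow> real^'k^'k) \<Rightarrow> 'd \<Rightarrow> nat \<Rightarrow> real" where
  "factor_weight \<iota> \<Lambda> i l =
     (if i \<in> range \<iota> then \<Lambda> l $ inv \<iota> i $ inv \<iota> i else 0)"

definition perturbation_matrix ::
    "nat \<Rightarrow> ('k \<Rightarrow> 'd) \<Rightarrow> (nat \<Rightarrow> real^'k^'k) \<Rightarrow> (nat \<Rightarrow> real^'d^'d) \<Rightarrow> real^'d^'d \<Rightarrow> real^'k^'d" where
  "perturbation_matrix L \<iota> \<Lambda> R Ubar = (\<chi> i j.
     if i = \<iota> j then 0
     else (\<Sum>l=1..L. (factor_weight \<iota> \<Lambda> i l - factor_weight \<iota> \<Lambda> (\<iota> j) l) *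
                      (column (\<iota> j) Ubar \<bullet> (R l *v column i Ubar)))
        / (\<Sum>l=1..L. (factor_weight \<iota> \<Lambda> i l - factor_weight \<iota> \<Lambda> (\<iota> j) l)\<^sup>2))"

end

theory Submission imports Defs begin

text \<open>
  In the basis \<open>Ubar\<close> the matrices become \<open>D l + \<epsilon> R' l\<close> with \<open>D l\<close> diagonal, and the minimizer
  becomes \<open>W = Ubar\<^sup>T Util\<close>. Put \<open>A l = W\<^sup>T (D l + \<epsilon> R' l) W\<close>. Comparing \<open>W\<close> with the identity shows
  that \<open>A l\<close> is diagonal up to \<open>O(\<epsilon>)\<close>, so every column \<open>w q\<close> of \<open>W\<close> is an approximate common
  eigenvector of the \<open>D l\<close>. As \<open>\<iota> j\<close> is separated from all other indices, a column \<open>w p\<close> whose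
  \<open>\<iota> j\<close>-th entry is not small equals \<open>\<plusminus>(e + x)\<close> with \<open>e\<close> the \<open>\<iota> j\<close>-th basis vector and \<open>x = O(\<epsilon>)\<close>.

  Indices outside the range of \<open>\<iota>\<close> may be rotated among themselves without changing any \<open>D l\<close>,
  so \<open>W\<close> need not be close to a signed permutation and cannot be expanded around one. Instead, stationarity under plane
  rotations gives \<open>\<Sum>\<^sub>l A l p q (A l p p - A l q q) = 0\<close> exactly. Inserting \<open>w p = \<plusminus>(e + x)\<close> and using the
  approximate eigenvector property of \<open>w q\<close>, this says that the vector \<open>y\<close> whose entries are the
  residuals of the linearized equation \<open>x = - \<epsilon> E\<close>, times its denominators, has inner product \<open>O(\<epsilon>\<^sup>2)\<close>
  with every \<open>w q\<close>. Since \<open>W\<close> is orthogonal, \<open>y = O(\<epsilon>\<^sup>2)\<close>. All constants depend only on \<open>L\<close>, the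
  dimension, and the size and separation of the weights, so the error term is uniform.
\<close>

section \<open>Entrywise estimates for an orthogonal matrix that nearly diagonalizes a perturbed
  diagonal family\<close>

lemma abs_sum_le_card:
  fixes f :: "'a \<Rightarrow> real"
  assumes "\<And>i. i \<in> S \<Longrightarrow> \<bar>f i\<bar> \<le> b"
  shows "\<bar>sum f S\<bar> \<le> real (card S) * b"
  using sum_norm_bound[of S f b] assms by simp

lemma matrix_mul_entry:
  "(X ** Y) $ i $ j = (\<Sum>k\<in>UNIV. X $ i $ k * Y $ k $ j)"
  by (simp add: matrix_matrix_mult_def)

text \<open>This is the problem in the coordinates of \<open>Ubar\<close>, reduced to entries:
  \<open>\<mu>\<close> holds the factor weights, \<open>R\<close> the transformed perturbations, and
  \<open>A\<close> the given matrices in the basis of the minimizer. Minimality enters only through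
  \<open>stationary\<close> and \<open>offdiag_le\<close>. Separation is required of the single
  index \<open>j\<close>, so all other weights may coincide.\<close>

locale near_diagonal =
  fixes L :: nat and \<mu> :: "'d::finite \<Rightarrow> nat \<Rightarrow> real" and R :: "nat \<Rightarrow> real^'d^'d"
    and W :: "real^'d^'d" and A :: "nat \<Rightarrow> real^'d^'d" and \<epsilon> B c n :: real and j :: 'd
  assumes n_def: "n = real CARD('d)"
    and orth: "orthogonal_matrix W"
    and A_eq: "l \<in> {1..L} \<Longrightarrow>
      A l = transpose W ** ((\<chi> i k. if i = k then \<mu> i l else 0) + \<epsilon> *\<^sub>R R l) ** W"
    and R_le: "l \<in> {1..L} \<Longrightarrow> \<bar>R l $ i $ k\<bar> \<le> 1"
    and \<mu>_le: "l \<in> {1..L} \<Longrightarrow> \<bar>\<mu> i l\<bar> \<le> B"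
    and B_nonneg: "0 \<le> B"
    and \<epsilon>_pos: "0 < \<epsilon>" and \<epsilon>_le: "\<epsilon> \<le> 1"
    and stationary: "p \<noteq> q \<Longrightarrow> (\<Sum>l=1..L. A l $ p $ q * (A l $ p $ p - A l $ q $ q)) = 0"
    and offdiag_le: "l \<in> {1..L} \<Longrightarrow> p \<noteq> q \<Longrightarrow> \<bar>A l $ p $ q\<bar> \<le> \<epsilon> * (L * n)"
    and c_pos: "0 < c"
    and gap: "i \<noteq> j \<Longrightarrow> \<exists>l\<in>{1..L}. c \<le> \<bar>\<mu> i l - \<mu> j l\<bar>"
begin

text \<open>Up to the stated power of \<open>\<epsilon>\<close>, the constants bound:
  \<open>K1\<close> the eigenvector residuals, \<open>K2\<close> the eigenvalue error,
  \<open>K3\<close> the small entries of column \<open>p\<close>, \<open>K4\<close> the deviation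
  \<open>x\<close>, \<open>K5\<close> the linear coefficients \<open>b\<close>, \<open>K6\<close>
  the products of \<open>y\<close> with the columns of \<open>W\<close> (order two), and
  \<open>K7\<close> the final error (order two). They are built from \<open>L\<close>,
  \<open>n\<close>, \<open>B\<close> and \<open>c\<close> alone, which makes the error uniform in
  the perturbation.\<close>

definition K1 :: real where "K1 = n * (L * n) + n"
definition K2 :: real where "K2 = n * K1"
definition K3 :: real where "K3 = 2 * K1 / c"
definition K4 :: real where "K4 = K3 + n * K3\<^sup>2"
definition K5 :: real where "K5 = 2 * B * K4 + 1"
definition K6 :: real where
  "K6 = L * (n * ((K1 + K2) * K5)) + L * ((2 * (n * (B + n))) * (n * (n * K4))) +
        n * (L * (2 * B * K5) * K4)"
definition K7 :: real where "K7 = n * (n * K6 / c\<^sup>2 + n * K3\<^sup>2)"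

lemma n_ge1: "1 \<le> n"
  by (simp add: n_def Suc_leI)

lemma consts_nonneg: "0 \<le> K1" "0 \<le> K2" "0 \<le> K3" "0 \<le> K4" "0 \<le> K5" "0 \<le> K6"
proof -
  show 1: "0 \<le> K1" using n_ge1 unfolding K1_def by simp
  show 2: "0 \<le> K2" using n_ge1 1 unfolding K2_def by simp
  show 3: "0 \<le> K3" using 1 c_pos unfolding K3_def by simp
  show 4: "0 \<le> K4" using n_ge1 3 unfolding K4_def by simp
  show 5: "0 \<le> K5" using B_nonneg 4 unfolding K5_def by simp
  show "0 \<le> K6" using n_ge1 B_nonneg 1 2 4 5 unfolding K6_def by simp
qed

lemma abs_sum_UNIV_le:
  fixes f :: "'d \<Rightarrow> real"
  assumes "\<And>i. \<bar>f i\<bar> \<le> b"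
  shows "\<bar>sum f UNIV\<bar> \<le> n * b"
  using abs_sum_le_card[of UNIV f b] assms by (simp add: n_def)

lemma col_orth: "(\<Sum>i\<in>UNIV. W $ i $ p * W $ i $ q) = (if p = q then 1 else 0)"
proof -
  have "(transpose W ** W) $ p $ q = (mat 1 :: real^'d^'d) $ p $ q"
    using orth by (simp add: orthogonal_matrix)
  then show ?thesis
    by (simp add: matrix_matrix_mult_def transpose_def mat_def)
qed

lemma row_orth: "(\<Sum>p\<in>UNIV. W $ i $ p * W $ k $ p) = (if i = k then 1 else 0)"
proof -
  have "(W ** transpose W) $ i $ k = (mat 1 :: real^'d^'d) $ i $ k"
    using orth by (simp add: orthogonal_matrix_def)
  then show ?thesis
    by (simp add: matrix_matrix_mult_def transpose_def mat_def)
qed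

lemma W_le: "\<bar>W $ i $ p\<bar> \<le> 1"
proof -
  have "(W $ i $ p)\<^sup>2 \<le> (\<Sum>i\<in>UNIV. (W $ i $ p)\<^sup>2)"
    by (rule member_le_sum) auto
  also have "\<dots> = 1"
    using col_orth[of p p] by (simp add: power2_eq_square)
  finally show ?thesis by (simp add: abs_square_le_1)
qed

definition RW :: "nat \<Rightarrow> 'd \<Rightarrow> 'd \<Rightarrow> real" where
  "RW l i q = (\<Sum>k\<in>UNIV. R l $ i $ k * W $ k $ q)"

lemma RW_le: assumes "l \<in> {1..L}" shows "\<bar>RW l i q\<bar> \<le> n"
proof -
  have "\<bar>R l $ i $ k * W $ k $ q\<bar> \<le> 1" for k
    using mult_mono[OF R_le[OF assms, of i k] W_le[of k q]] by (simp add: abs_mult)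
  from abs_sum_UNIV_le[OF this] show ?thesis unfolding RW_def by simp
qed

lemma NW_entry:
  assumes "l \<in> {1..L}"
  shows "((((\<chi> i k. if i = k then \<mu> i l else 0) + \<epsilon> *\<^sub>R R l) ** W) $ i $ q)
    = \<mu> i l * W $ i $ q + \<epsilon> * RW l i q"
  by (simp add: matrix_matrix_mult_def RW_def distrib_right sum.distrib if_distrib[of "\<lambda>x. x * _"]
      sum_distrib_left mult.assoc cong: if_cong)

lemma A_entry:
  assumes "l \<in> {1..L}"
  shows "A l $ p $ q = (\<Sum>i\<in>UNIV. W $ i $ p * (\<mu> i l * W $ i $ q + \<epsilon> * RW l i q))"
proof -
  have "A l = transpose W ** (((\<chi> i k. if i = k then \<mu> i l else 0) + \<epsilon> *\<^sub>R R l) ** W)"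
    by (simp add: A_eq[OF assms] matrix_mul_assoc)
  then have "A l $ p $ q = (\<Sum>i\<in>UNIV. transpose W $ p $ i *
      ((((\<chi> i k. if i = k then \<mu> i l else 0) + \<epsilon> *\<^sub>R R l) ** W) $ i $ q))"
    by (simp only: matrix_mul_entry)
  then show ?thesis
    unfolding NW_entry[OF assms] by (simp add: transpose_def)
qed

text \<open>Multiplying \<open>A_eq\<close> by \<open>W\<close> from the left cancels
  \<open>transpose W\<close>, so \<open>W ** A l\<close> is the perturbed diagonal matrix times
  \<open>W\<close>.\<close>

lemma WA_entry:
  assumes "l \<in> {1..L}"
  shows "(\<Sum>p\<in>UNIV. W $ i $ p * A l $ p $ q) = \<mu> i l * W $ i $ q + \<epsilon> * RW l i q"
proof -
  have "W ** A l = (W ** transpose W) ** (((\<chi> i k. if i = k then \<mu> i l else 0) + \<epsilon> *\<^sub>R R l) ** W)"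
    by (simp add: A_eq[OF assms] matrix_mul_assoc)
  also have "\<dots> = ((\<chi> i k. if i = k then \<mu> i l else 0) + \<epsilon> *\<^sub>R R l) ** W"
    using orth by (simp add: orthogonal_matrix_def)
  finally have "(W ** A l) $ i $ q = \<mu> i l * W $ i $ q + \<epsilon> * RW l i q"
    by (simp add: NW_entry[OF assms])
  then show ?thesis
    by (simp add: matrix_matrix_mult_def)
qed

text \<open>In \<open>WA_entry\<close> the term with \<open>p = q\<close> is kept; the other terms
  carry off-diagonal entries of \<open>A l\<close> and the perturbation term carries
  \<open>\<epsilon>\<close>.\<close>

lemma almost_eigen:
  assumes "l \<in> {1..L}"
  shows "\<bar>W $ i $ q * (\<mu> i l - A l $ q $ q)\<bar> \<le> \<epsilon> * K1"
proof -
  have "W $ i $ q * (\<mu> i l - A l $ q $ q) =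
      (\<Sum>p\<in>UNIV. if p = q then 0 else W $ i $ p * A l $ p $ q) - \<epsilon> * RW l i q"
    using WA_entry[OF assms, of i q]
    by (simp add: sum.remove[of UNIV q] sum.If_cases Compl_eq_Diff_UNIV algebra_simps)
  moreover have "\<bar>\<Sum>p\<in>UNIV. if p = q then 0 else W $ i $ p * A l $ p $ q\<bar> \<le> n * (\<epsilon> * (L * n))"
  proof (rule abs_sum_UNIV_le)
    fix p show "\<bar>if p = q then 0 else W $ i $ p * A l $ p $ q\<bar> \<le> \<epsilon> * (L * n)"
      using mult_mono[OF W_le[of i p] offdiag_le[OF assms, of p q]] \<epsilon>_pos n_ge1
      by (auto simp: abs_mult)
  qed
  moreover have "\<bar>\<epsilon> * RW l i q\<bar> \<le> \<epsilon> * n"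
    using RW_le[OF assms] \<epsilon>_pos by (simp add: abs_mult)
  ultimately show ?thesis
    unfolding K1_def by (simp add: algebra_simps)
qed


lemma A_diag_le:
  assumes "l \<in> {1..L}"
  shows "\<bar>A l $ q $ q\<bar> \<le> n * (B + n)"
  unfolding A_entry[OF assms]
proof (rule abs_sum_UNIV_le)
  fix i
  have "\<bar>\<mu> i l * W $ i $ q\<bar> \<le> B"
    using mult_mono[OF \<mu>_le[OF assms, of i] W_le[of i q]] B_nonneg by (simp add: abs_mult)
  moreover have "\<bar>\<epsilon> * RW l i q\<bar> \<le> n"
    using mult_mono[OF \<epsilon>_le RW_le[OF assms, of i q]] \<epsilon>_pos by (simp add: abs_mult)
  ultimately have "\<bar>\<mu> i l * W $ i $ q + \<epsilon> * RW l i q\<bar> \<le> B + n"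
    by linarith
  from mult_mono[OF W_le[of i q] this]
  show "\<bar>W $ i $ q * (\<mu> i l * W $ i $ q + \<epsilon> * RW l i q)\<bar> \<le> B + n"
    by (simp add: abs_mult)
qed

text \<open>Row \<open>j\<close> is a unit vector with \<open>n\<close> entries of modulus at most
  1. If all moduli were below \<open>1 / n\<close>, so would be the squares, which then could not
  sum to 1.\<close>

lemma ex_large_entry: "\<exists>p. 1 / n \<le> \<bar>W $ j $ p\<bar>"
proof (rule ccontr)
  assume "\<not> ?thesis"
  then have *: "\<bar>W $ j $ p\<bar> < 1 / n" for p
    by (simp add: not_le)
  have "(W $ j $ p)\<^sup>2 < 1 / n" for p
  proof -
    have "(W $ j $ p)\<^sup>2 \<le> \<bar>W $ j $ p\<bar>"
      using mult_left_le[OF W_le[of j p], of "\<bar>W $ j $ p\<bar>"] by (simp add: power2_eq_square)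
    with *[of p] show ?thesis by linarith
  qed
  then have "(\<Sum>p\<in>UNIV. (W $ j $ p)\<^sup>2) < (\<Sum>p\<in>(UNIV::'d set). 1 / n)"
    by (intro sum_strict_mono) auto
  then show False
    using row_orth[of j j] n_ge1 by (simp add: power2_eq_square n_def)
qed

text \<open>One column of the perturbation matrix: in the coordinates of \<open>Ubar\<close> the
  forms of the perturbation on basis vectors are entries of \<open>R l\<close>.\<close>

definition E :: "'d \<Rightarrow> real" where
  "E i = (if i = j then 0
    else (\<Sum>l=1..L. (\<mu> i l - \<mu> j l) * R l $ j $ i) / (\<Sum>l=1..L. (\<mu> i l - \<mu> j l)\<^sup>2))"

section \<open>First-order expansion of the column \<open>p\<close> matched to the separated index
  \<open>j\<close>\<close>

context
  fixes p :: 'd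
  assumes large: "1 / n \<le> \<bar>W $ j $ p\<bar>"
    and small: "\<epsilon> * K2 \<le> c / 2"
begin

text \<open>The factor \<open>W $ j $ p\<close> in \<open>almost_eigen\<close> can be divided out at
  the cost of \<open>n\<close>, by \<open>large\<close>.\<close>

lemma eigenvalue_close:
  assumes "l \<in> {1..L}"
  shows "\<bar>\<mu> j l - A l $ p $ p\<bar> \<le> \<epsilon> * K2"
proof -
  have "1 / n * \<bar>\<mu> j l - A l $ p $ p\<bar> \<le> \<bar>W $ j $ p\<bar> * \<bar>\<mu> j l - A l $ p $ p\<bar>"
    by (rule mult_right_mono[OF large]) simp
  also have "\<dots> \<le> \<epsilon> * K1"
    using almost_eigen[OF assms, of j p] by (simp add: abs_mult)
  finally show ?thesis
    using n_ge1 by (simp add: K2_def field_simps)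
qed

text \<open>Some \<open>l\<close> separates \<open>i\<close> from \<open>j\<close> by
  \<open>c\<close>. Since \<open>A l $ p $ p\<close> is within \<open>c / 2\<close> of
  \<open>\<mu> j l\<close>, it stays \<open>c / 2\<close> away from \<open>\<mu> i l\<close>, and
  \<open>almost_eigen\<close> forces the entry to be small.\<close>

lemma off_entry_le:
  assumes "i \<noteq> j"
  shows "\<bar>W $ i $ p\<bar> \<le> \<epsilon> * K3"
proof -
  obtain l where l: "l \<in> {1..L}" "c \<le> \<bar>\<mu> i l - \<mu> j l\<bar>"
    using gap[OF assms] by blast
  have "c / 2 \<le> \<bar>\<mu> i l - A l $ p $ p\<bar>"
    using l(2) eigenvalue_close[OF l(1)] small by linarith
  then have "\<bar>W $ i $ p\<bar> * (c / 2) \<le> \<bar>W $ i $ p\<bar> * \<bar>\<mu> i l - A l $ p $ p\<bar>"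
    by (rule mult_left_mono) simp
  also have "\<dots> \<le> \<epsilon> * K1"
    using almost_eigen[OF l(1), of i p] by (simp add: abs_mult)
  finally show ?thesis
    using c_pos by (simp add: K3_def field_simps)
qed

text \<open>The factor \<open>sgn (W $ j $ p)\<close> removes the sign ambiguity of the
  column.\<close>

definition x :: "'d \<Rightarrow> real" where
  "x i = sgn (W $ j $ p) * W $ i $ p - (if i = j then 1 else 0)"

lemma x_off_le: "i \<noteq> j \<Longrightarrow> \<bar>x i\<bar> \<le> \<epsilon> * K3"
  using off_entry_le[of i] large n_ge1 by (auto simp: x_def abs_mult sgn_if)

text \<open>Normalization makes this entry second order: \<open>1 - \<bar>W $ j $ p\<bar>\<close> is
  at most one minus the square, which is the sum of the squares of the other entries.\<close>

lemma x_diag_le: "\<bar>x j\<bar> \<le> \<epsilon>\<^sup>2 * (n * K3\<^sup>2)"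
proof -
  have "\<bar>x j\<bar> = 1 - \<bar>W $ j $ p\<bar>"
    using W_le[of j p] by (auto simp: x_def sgn_if)
  also have "\<dots> \<le> 1 - (W $ j $ p)\<^sup>2"
    using mult_left_le[OF W_le[of j p], of "\<bar>W $ j $ p\<bar>"] by (simp add: power2_eq_square)
  also have "\<dots> = (\<Sum>i\<in>UNIV. if i = j then 0 else (W $ i $ p)\<^sup>2)"
    using col_orth[of p p]
    by (simp add: sum.remove[of UNIV j] sum.If_cases Compl_eq_Diff_UNIV power2_eq_square)
  also have "\<dots> \<le> \<bar>\<Sum>i\<in>UNIV. if i = j then 0 else (W $ i $ p)\<^sup>2\<bar>"
    by simp
  also have "\<dots> \<le> n * (\<epsilon> * K3)\<^sup>2"
  proof (rule abs_sum_UNIV_le)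
    fix i show "\<bar>if i = j then 0 else (W $ i $ p)\<^sup>2\<bar> \<le> (\<epsilon> * K3)\<^sup>2"
      using power_mono[OF off_entry_le[of i], of 2] by auto
  qed
  finally show ?thesis by (simp add: power_mult_distrib algebra_simps)
qed

lemma x_le: "\<bar>x i\<bar> \<le> \<epsilon> * K4"
proof -
  have "\<epsilon>\<^sup>2 \<le> \<epsilon>"
    using \<epsilon>_pos \<epsilon>_le by (simp add: power2_eq_square mult_left_le)
  then have "\<epsilon>\<^sup>2 * (n * K3\<^sup>2) \<le> \<epsilon> * (n * K3\<^sup>2)"
    using n_ge1 by (intro mult_right_mono) auto
  moreover have "0 \<le> \<epsilon> * (n * K3\<^sup>2)" "0 \<le> \<epsilon> * K3"
    using \<epsilon>_pos n_ge1 consts_nonneg by auto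
  ultimately show ?thesis
    using x_off_le[of i] x_diag_le unfolding K4_def distrib_left
    by (cases "i = j") (auto simp: abs_le_iff)
qed

text \<open>Columns \<open>p\<close> and \<open>q\<close> are orthogonal, and column
  \<open>p\<close> is, up to sign, the \<open>j\<close>-th basis vector plus
  \<open>x\<close>.\<close>

lemma W_j_eq: assumes "q \<noteq> p" shows "W $ j $ q = - (\<Sum>i\<in>UNIV. x i * W $ i $ q)"
proof -
  have "0 = sgn (W $ j $ p) * (\<Sum>i\<in>UNIV. W $ i $ p * W $ i $ q)"
    using col_orth[of p q] assms by simp
  also have "\<dots> = (\<Sum>i\<in>UNIV. (x i + (if i = j then 1 else 0)) * W $ i $ q)"
    by (simp add: x_def sum_distrib_left mult.assoc)
  also have "\<dots> = (\<Sum>i\<in>UNIV. x i * W $ i $ q) + W $ j $ q"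
    by (simp add: distrib_right sum.distrib if_distrib[of "\<lambda>x. x * _"] cong: if_cong)
  finally show ?thesis by simp
qed

text \<open>These are the coefficients, with respect to the entries of column \<open>q\<close>, of
  the leading part of \<open>A l $ p $ q\<close> up to sign.\<close>

definition b :: "nat \<Rightarrow> 'd \<Rightarrow> real" where
  "b l i = (\<mu> i l - \<mu> j l) * x i + \<epsilon> * R l $ j $ i"

lemma b_le:
  assumes "l \<in> {1..L}"
  shows "\<bar>b l i\<bar> \<le> \<epsilon> * K5"
proof -
  have "\<bar>\<mu> i l - \<mu> j l\<bar> \<le> 2 * B"
    using \<mu>_le[OF assms, of i] \<mu>_le[OF assms, of j] by linarith
  from mult_mono[OF this x_le[of i]] have "\<bar>(\<mu> i l - \<mu> j l) * x i\<bar> \<le> 2 * B * (\<epsilon> * K4)"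
    using B_nonneg by (simp add: abs_mult)
  moreover have "\<bar>\<epsilon> * R l $ j $ i\<bar> \<le> \<epsilon>"
    using R_le[OF assms, of j i] \<epsilon>_pos by (simp add: abs_mult)
  ultimately show ?thesis
    unfolding b_def K5_def by (simp add: algebra_simps)
qed

text \<open>Substituting the basis vector plus \<open>x\<close> for column \<open>p\<close> leaves a
  zeroth-order term \<open>\<mu> j l * W $ j $ q\<close>. \<open>W_j_eq\<close> rewrites it through
  \<open>x\<close>, which produces the weight differences in \<open>b\<close>.\<close>

lemma A_offdiag_expansion:
  assumes "l \<in> {1..L}" "q \<noteq> p"
  shows "sgn (W $ j $ p) * A l $ p $ q =
    (\<Sum>i\<in>UNIV. W $ i $ q * b l i) + \<epsilon> * (\<Sum>i\<in>UNIV. x i * RW l i q)"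
proof -
  have "sgn (W $ j $ p) * A l $ p $ q =
      (\<Sum>i\<in>UNIV. (x i + (if i = j then 1 else 0)) * (\<mu> i l * W $ i $ q + \<epsilon> * RW l i q))"
    unfolding A_entry[OF assms(1)] by (simp add: x_def sum_distrib_left mult.assoc)
  also have "\<dots> = (\<Sum>i\<in>UNIV. x i * \<mu> i l * W $ i $ q) + \<epsilon> * (\<Sum>i\<in>UNIV. x i * RW l i q)
      + \<mu> j l * W $ j $ q + \<epsilon> * RW l j q"
    by (simp add: distrib_left distrib_right sum.distrib sum_distrib_left algebra_simps
        if_distrib[of "\<lambda>x. x * _"] if_distrib[of "\<lambda>x. _ * x"] cong: if_cong)
  also have "\<dots> = (\<Sum>i\<in>UNIV. W $ i $ q * b l i) + \<epsilon> * (\<Sum>i\<in>UNIV. x i * RW l i q)"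
    unfolding W_j_eq[OF assms(2)] RW_def b_def
    by (simp add: sum_distrib_left sum.distrib sum_subtractf algebra_simps)
  finally show ?thesis .
qed

text \<open>For \<open>i \<noteq> j\<close> this equals \<open>x i + \<epsilon> * E i\<close> times
  the denominator of \<open>E i\<close>.\<close>

definition y :: "'d \<Rightarrow> real" where
  "y i = (\<Sum>l=1..L. (\<mu> i l - \<mu> j l) * b l i)"

lemma y_j: "y j = 0"
  by (simp add: y_def)

lemma y_le: "\<bar>y i\<bar> \<le> \<epsilon> * (L * (2 * B * K5))"
proof -
  have "\<bar>y i\<bar> \<le> card {1..L} * (2 * B * (\<epsilon> * K5))"
    unfolding y_def
  proof (rule abs_sum_le_card)
    fix l assume l: "l \<in> {1..L}"
    have "\<bar>\<mu> i l - \<mu> j l\<bar> \<le> 2 * B"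
      using \<mu>_le[OF l, of i] \<mu>_le[OF l, of j] by linarith
    from mult_mono[OF this b_le[OF l, of i]]
    show "\<bar>(\<mu> i l - \<mu> j l) * b l i\<bar> \<le> 2 * B * (\<epsilon> * K5)"
      using B_nonneg by (simp add: abs_mult)
  qed
  then show ?thesis by (simp add: algebra_simps)
qed

text \<open>The one large entry of column \<open>p\<close> meets \<open>y j = 0\<close>; every other
  product has two factors of order \<open>\<epsilon>\<close>.\<close>

lemma y_W_le_diag: "\<bar>\<Sum>i\<in>UNIV. y i * W $ i $ p\<bar> \<le> \<epsilon>\<^sup>2 * (n * (L * (2 * B * K5) * K4))"
proof -
  have "\<bar>\<Sum>i\<in>UNIV. y i * W $ i $ p\<bar> \<le> n * (\<epsilon> * (L * (2 * B * K5)) * (\<epsilon> * K4))"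
  proof (rule abs_sum_UNIV_le)
    fix i
    have "\<bar>y i * W $ i $ p\<bar> = \<bar>y i\<bar> * \<bar>x i\<bar>"
      using large n_ge1 y_j by (cases "i = j") (auto simp: x_def abs_mult sgn_if)
    also have "\<dots> \<le> \<epsilon> * (L * (2 * B * K5)) * (\<epsilon> * K4)"
      using mult_mono[OF y_le[of i] x_le[of i]] \<epsilon>_pos B_nonneg consts_nonneg by simp
    finally show "\<bar>y i * W $ i $ p\<bar> \<le> \<epsilon> * (L * (2 * B * K5)) * (\<epsilon> * K4)" .
  qed
  then show ?thesis by (simp add: power2_eq_square algebra_simps)
qed

lemma xRW_le:
  assumes "l \<in> {1..L}"
  shows "\<bar>\<Sum>i\<in>UNIV. x i * RW l i q\<bar> \<le> \<epsilon> * (n * (n * K4))"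
proof -
  have "\<bar>\<Sum>i\<in>UNIV. x i * RW l i q\<bar> \<le> n * (\<epsilon> * K4 * n)"
  proof (rule abs_sum_UNIV_le)
    fix i show "\<bar>x i * RW l i q\<bar> \<le> \<epsilon> * K4 * n"
      using mult_mono[OF x_le[of i] RW_le[OF assms, of i q]] \<epsilon>_pos consts_nonneg
      by (simp add: abs_mult)
  qed
  then show ?thesis by (simp add: algebra_simps)
qed

text \<open>Since column \<open>q\<close> of \<open>W\<close> is an approximate eigenvector, \<open>\<mu> i l\<close> may be traded for
  \<open>A l $ q $ q\<close> up to \<open>O(\<epsilon>)\<close>; stationarity then annihilates the main term.\<close>
lemma y_W_le_off:
  assumes "q \<noteq> p"
  shows "\<bar>\<Sum>i\<in>UNIV. y i * W $ i $ q\<bar> \<le>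
    \<epsilon>\<^sup>2 * (L * (n * ((K1 + K2) * K5)) + L * ((2 * (n * (B + n))) * (n * (n * K4))))"
proof -
  define \<sigma> where "\<sigma> = sgn (W $ j $ p)"
  \<comment> \<open>\<open>g\<close> is the error of replacing the weight difference
    \<open>\<mu> i l - \<mu> j l\<close> by \<open>A l $ q $ q - A l $ p $ p\<close>, multiplied by
    \<open>W $ i $ q\<close>. Its two parts are controlled by \<open>almost_eigen\<close> and
    \<open>eigenvalue_close\<close>.\<close>
  define g where "g l i = W $ i $ q * (\<mu> i l - A l $ q $ q) + W $ i $ q * (A l $ p $ p - \<mu> j l)"
    for l i
  define e where "e l = (\<Sum>i\<in>UNIV. x i * RW l i q)" for l
  have main: "(\<Sum>l=1..L. (A l $ q $ q - A l $ p $ p) * (\<Sum>i\<in>UNIV. W $ i $ q * b l i)) =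
      (\<Sum>l=1..L. (A l $ p $ p - A l $ q $ q) * (\<epsilon> * e l))"
  proof -
    have "(\<Sum>l=1..L. (A l $ q $ q - A l $ p $ p) * (\<Sum>i\<in>UNIV. W $ i $ q * b l i)) =
      (\<Sum>l=1..L. (A l $ p $ p - A l $ q $ q) * (\<epsilon> * e l) -
                 \<sigma> * (A l $ p $ q * (A l $ p $ p - A l $ q $ q)))"
    proof (rule sum.cong[OF refl])
      fix l assume "l \<in> {1..L}"
      from A_offdiag_expansion[OF this assms]
      have *: "(\<Sum>i\<in>UNIV. W $ i $ q * b l i) = \<sigma> * A l $ p $ q - \<epsilon> * e l"
        by (simp add: e_def \<sigma>_def)
      show "(A l $ q $ q - A l $ p $ p) * (\<Sum>i\<in>UNIV. W $ i $ q * b l i) =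
          (A l $ p $ p - A l $ q $ q) * (\<epsilon> * e l) -
                 \<sigma> * (A l $ p $ q * (A l $ p $ p - A l $ q $ q))"
        unfolding * by (simp add: algebra_simps)
    qed
    also have "\<dots> = (\<Sum>l=1..L. (A l $ p $ p - A l $ q $ q) * (\<epsilon> * e l))"
      unfolding sum_subtractf sum_distrib_left[symmetric] using stationary[of p q] assms by simp
    finally show ?thesis .
  qed
  have "(\<Sum>i\<in>UNIV. y i * W $ i $ q) =
      (\<Sum>l=1..L. \<Sum>i\<in>UNIV. (\<mu> i l - \<mu> j l) * b l i * W $ i $ q)"
    unfolding y_def sum_distrib_right by (rule sum.swap)
  also have "\<dots> = (\<Sum>l=1..L. (\<Sum>i\<in>UNIV. g l i * b l i) +
      (A l $ q $ q - A l $ p $ p) * (\<Sum>i\<in>UNIV. W $ i $ q * b l i))"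
    by (simp add: g_def sum_distrib_left sum.distrib[symmetric] algebra_simps)
  also have "\<dots> = (\<Sum>l=1..L. \<Sum>i\<in>UNIV. g l i * b l i) +
      (\<Sum>l=1..L. (A l $ p $ p - A l $ q $ q) * (\<epsilon> * e l))"
    by (simp only: sum.distrib main)
  finally have eq: "(\<Sum>i\<in>UNIV. y i * W $ i $ q) = \<dots>" .
  have "\<bar>\<Sum>l=1..L. \<Sum>i\<in>UNIV. g l i * b l i\<bar> \<le>
      card {1..L} * (n * (\<epsilon> * (K1 + K2) * (\<epsilon> * K5)))"
  proof (intro abs_sum_le_card abs_sum_UNIV_le)
    fix l i assume l: "l \<in> {1..L}"
    have "\<bar>W $ i $ q * (A l $ p $ p - \<mu> j l)\<bar> \<le> \<epsilon> * K2"
      using mult_mono[OF W_le[of i q] eigenvalue_close[OF l]]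
      by (simp add: abs_mult abs_minus_commute)
    then have "\<bar>g l i\<bar> \<le> \<epsilon> * (K1 + K2)"
      using almost_eigen[OF l, of i q] unfolding g_def distrib_left by linarith
    from mult_mono[OF this b_le[OF l, of i]]
    show "\<bar>g l i * b l i\<bar> \<le> \<epsilon> * (K1 + K2) * (\<epsilon> * K5)"
      using \<epsilon>_pos consts_nonneg by (simp add: abs_mult)
  qed
  moreover have "\<bar>\<Sum>l=1..L. (A l $ p $ p - A l $ q $ q) * (\<epsilon> * e l)\<bar> \<le>
      card {1..L} * (2 * (n * (B + n)) * (\<epsilon> * (\<epsilon> * (n * (n * K4)))))"
  proof (intro abs_sum_le_card)
    fix l assume l: "l \<in> {1..L}"
    have 1: "\<bar>A l $ p $ p - A l $ q $ q\<bar> \<le> 2 * (n * (B + n))"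
      using A_diag_le[OF l, of p] A_diag_le[OF l, of q] by linarith
    have 2: "\<bar>\<epsilon> * e l\<bar> \<le> \<epsilon> * (\<epsilon> * (n * (n * K4)))"
      using xRW_le[OF l, of q] \<epsilon>_pos by (simp add: abs_mult e_def)
    from mult_mono[OF 1 2]
    show "\<bar>(A l $ p $ p - A l $ q $ q) * (\<epsilon> * e l)\<bar> \<le>
        2 * (n * (B + n)) * (\<epsilon> * (\<epsilon> * (n * (n * K4))))"
      using B_nonneg n_ge1 by (simp add: abs_mult)
  qed
  ultimately show ?thesis
    unfolding eq by (simp add: power2_eq_square algebra_simps)
qed

lemma y_W_le: "\<bar>\<Sum>i\<in>UNIV. y i * W $ i $ q\<bar> \<le> \<epsilon>\<^sup>2 * K6"
proof -
  have "0 \<le> \<epsilon>\<^sup>2 * (n * (L * (2 * B * K5) * K4))"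
    "0 \<le> \<epsilon>\<^sup>2 * (L * (n * ((K1 + K2) * K5)) + L * ((2 * (n * (B + n))) * (n * (n * K4))))"
    using consts_nonneg n_ge1 B_nonneg by auto
  then show ?thesis
    using y_W_le_diag y_W_le_off[of q] unfolding K6_def distrib_left[of "\<epsilon>\<^sup>2"]
    by (cases "q = p") (simp, linarith)
qed

text \<open>The columns of \<open>W\<close> form an orthonormal basis, so \<open>y\<close> is
  recovered from its products with them.\<close>

lemma y_small: "\<bar>y i\<bar> \<le> \<epsilon>\<^sup>2 * (n * K6)"
proof -
  have "(\<Sum>q\<in>UNIV. W $ i $ q * (\<Sum>k\<in>UNIV. y k * W $ k $ q)) =
      (\<Sum>k\<in>UNIV. y k * (\<Sum>q\<in>UNIV. W $ i $ q * W $ k $ q))"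
    unfolding sum_distrib_left by (subst sum.swap) (simp add: mult_ac)
  also have "\<dots> = y i"
    by (simp add: row_orth if_distrib[of "\<lambda>x. _ * x"] cong: if_cong)
  finally have "y i = (\<Sum>q\<in>UNIV. W $ i $ q * (\<Sum>k\<in>UNIV. y k * W $ k $ q))" ..
  also have "\<bar>\<dots>\<bar> \<le> n * (\<epsilon>\<^sup>2 * K6)"
  proof (rule abs_sum_UNIV_le)
    fix q show "\<bar>W $ i $ q * (\<Sum>k\<in>UNIV. y k * W $ k $ q)\<bar> \<le> \<epsilon>\<^sup>2 * K6"
      using mult_mono[OF W_le[of i q] y_W_le[of q]] by (simp add: abs_mult)
  qed
  finally show ?thesis by (simp add: algebra_simps)
qed

lemma first_order_entry: "\<bar>x i + \<epsilon> * E i\<bar> \<le> \<epsilon>\<^sup>2 * (n * K6 / c\<^sup>2 + n * K3\<^sup>2)"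
proof (cases "i = j")
  \<comment> \<open>Here \<open>E\<close> vanishes and \<open>x j\<close> is already of second
    order.\<close>
  case True
  have "0 \<le> \<epsilon>\<^sup>2 * (n * K6 / c\<^sup>2)"
    using consts_nonneg n_ge1 by simp
  with True show ?thesis
    using x_diag_le unfolding distrib_left by (simp add: E_def)
next
  case False
  define S where "S = (\<Sum>l=1..L. (\<mu> i l - \<mu> j l)\<^sup>2)"
  have "c\<^sup>2 \<le> S"
  proof -
    obtain l where l: "l \<in> {1..L}" "c \<le> \<bar>\<mu> i l - \<mu> j l\<bar>"
      using gap[OF False] by blast
    have "c\<^sup>2 \<le> (\<mu> i l - \<mu> j l)\<^sup>2"
      using power_mono[OF l(2), of 2] c_pos by simp
    also have "\<dots> \<le> S"
      unfolding S_def using l(1) by (intro member_le_sum) auto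
    finally show ?thesis .
  qed
  moreover have "0 < c\<^sup>2" using c_pos by simp
  ultimately have S: "0 < S" by linarith
  have "y i = S * x i + \<epsilon> * (\<Sum>l=1..L. (\<mu> i l - \<mu> j l) * R l $ j $ i)"
  proof -
    have "y i = (\<Sum>l=1..L. (\<mu> i l - \<mu> j l)\<^sup>2 * x i +
        \<epsilon> * ((\<mu> i l - \<mu> j l) * R l $ j $ i))"
      unfolding y_def b_def by (simp add: power2_eq_square algebra_simps)
    then show ?thesis
      unfolding S_def by (simp only: sum.distrib sum_distrib_left sum_distrib_right)
  qed
  then have "x i + \<epsilon> * E i = y i / S"
    using False S unfolding E_def S_def[symmetric] by (simp add: field_simps)
  then have "\<bar>x i + \<epsilon> * E i\<bar> = \<bar>y i\<bar> / S"
    using S by simp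
  also have "\<dots> \<le> \<epsilon>\<^sup>2 * (n * K6) / c\<^sup>2"
    using y_small[of i] \<open>c\<^sup>2 \<le> S\<close> \<open>0 < c\<^sup>2\<close> by (intro frac_le) auto
  also have "\<dots> \<le> \<epsilon>\<^sup>2 * (n * K6 / c\<^sup>2 + n * K3\<^sup>2)"
    using n_ge1 by (simp add: distrib_left)
  finally show ?thesis .
qed

text \<open>The deviation is \<open>- \<epsilon> * E\<close> plus a remainder whose norm is at most
  the sum of its entrywise bounds.\<close>

lemma column_le:
  "norm (sgn (W $ j $ p) *\<^sub>R column p W - axis j 1) \<le>
    \<epsilon> * sqrt (\<Sum>i\<in>UNIV. (E i)\<^sup>2) + \<epsilon>\<^sup>2 * K7"
proof -
  define v :: "real^'d" where "v = (\<chi> i. E i)"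
  have norm_v: "norm v = sqrt (\<Sum>i\<in>UNIV. (E i)\<^sup>2)"
    unfolding norm_eq_sqrt_inner inner_vec_def by (simp add: v_def power2_eq_square)
  have "sgn (W $ j $ p) *\<^sub>R column p W - axis j 1 = (\<chi> i. x i + \<epsilon> * E i) - \<epsilon> *\<^sub>R v"
    by (auto simp: vec_eq_iff x_def v_def axis_def column_def)
  also have "norm \<dots> \<le> norm (\<chi> i. x i + \<epsilon> * E i) + norm (\<epsilon> *\<^sub>R v)"
    by (rule norm_triangle_ineq4)
  also have "norm (\<epsilon> *\<^sub>R v) = \<epsilon> * sqrt (\<Sum>i\<in>UNIV. (E i)\<^sup>2)"
    using \<epsilon>_pos by (simp add: norm_v)
  also have "norm (\<chi> i. x i + \<epsilon> * E i) \<le> (\<Sum>i\<in>UNIV. \<bar>x i + \<epsilon> * E i\<bar>)"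
    using norm_le_l1_cart[of "\<chi> i. x i + \<epsilon> * E i"] by simp
  also have "\<dots> \<le> n * (\<epsilon>\<^sup>2 * (n * K6 / c\<^sup>2 + n * K3\<^sup>2))"
    using abs_sum_UNIV_le[of "\<lambda>i. \<bar>x i + \<epsilon> * E i\<bar>"] first_order_entry by simp
  also have "\<dots> = \<epsilon>\<^sup>2 * K7"
    by (simp add: K7_def)
  finally show ?thesis by simp
qed

end

end

section \<open>Orthogonal congruences and the objective\<close>

lemma matrix_inv_orthogonal:
  fixes V :: "real^'n^'n"
  assumes "orthogonal_matrix V"
  shows "matrix_inv V = transpose V"
  unfolding matrix_inv_def
proof (rule some_equality)
  show "V ** transpose V = mat 1 \<and> transpose V ** V = mat 1"
    using assms by (simp add: orthogonal_matrix_def)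
  fix X assume X: "V ** X = mat 1 \<and> X ** V = mat 1"
  have "X = (transpose V ** V) ** X"
    using assms by (simp add: orthogonal_matrix_def)
  also have "\<dots> = transpose V"
    using X by (simp add: matrix_mul_assoc[symmetric])
  finally show "X = transpose V" .
qed

lemma norm_orthogonal_matrix_mult:
  fixes Q :: "real^'n^'n"
  assumes "orthogonal_matrix Q"
  shows "norm (Q *v x) = norm x"
proof -
  have "orthogonal_transformation ((*v) Q)"
    using assms by (simp add: orthogonal_transformation_matrix)
  then show ?thesis by (simp add: orthogonal_transformation)
qed

lemma congruence_entry:
  fixes V M :: "real^'n^'n"
  shows "(transpose V ** M ** V) $ i $ k = column i V \<bullet> (M *v column k V)"
  unfolding matrix_mul_assoc[symmetric] matrix_mul_entry[of "transpose V"]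
  by (simp add: inner_vec_def transpose_def column_def matrix_vector_mult_def matrix_mul_entry)

lemma frobenius_orthogonal_left:
  fixes Q M :: "real^'n^'n"
  assumes "orthogonal_matrix Q"
  shows "(\<Sum>i\<in>UNIV. \<Sum>j\<in>UNIV. ((Q ** M) $ i $ j)\<^sup>2) = (\<Sum>i\<in>UNIV. \<Sum>j\<in>UNIV. (M $ i $ j)\<^sup>2)"
proof -
  have "(\<Sum>i\<in>UNIV. ((Q ** M) $ i $ j)\<^sup>2) = (\<Sum>i\<in>UNIV. (M $ i $ j)\<^sup>2)" for j
  proof -
    have "(norm (Q *v column j M))\<^sup>2 = (norm (column j M))\<^sup>2"
      by (simp add: norm_orthogonal_matrix_mult[OF assms])
    then show ?thesis
      unfolding power2_norm_eq_inner inner_vec_def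
      by (simp add: matrix_vector_mult_def column_def matrix_mul_entry power2_eq_square)
  qed
  then show ?thesis
    by (subst (1 2) sum.swap) simp
qed

text \<open>Invariance under left multiplication is applied twice, the second time after a
  transposition.\<close>

lemma frobenius_congruence:
  fixes V M :: "real^'n^'n"
  assumes "orthogonal_matrix V"
  shows "(\<Sum>i\<in>UNIV. \<Sum>j\<in>UNIV. ((transpose V ** M ** V) $ i $ j)\<^sup>2) =
    (\<Sum>i\<in>UNIV. \<Sum>j\<in>UNIV. (M $ i $ j)\<^sup>2)"
proof -
  have tr: "(\<Sum>i\<in>UNIV. \<Sum>j\<in>UNIV. (transpose X $ i $ j)\<^sup>2) =
      (\<Sum>i\<in>UNIV. \<Sum>j\<in>UNIV. (X $ i $ j)\<^sup>2)" for X :: "real^'n^'n"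
    by (subst sum.swap) (simp add: transpose_def)
  have V: "orthogonal_matrix (transpose V)"
    using assms by simp
  have "(\<Sum>i\<in>UNIV. \<Sum>j\<in>UNIV. ((transpose V ** M ** V) $ i $ j)\<^sup>2) =
      (\<Sum>i\<in>UNIV. \<Sum>j\<in>UNIV. ((M ** V) $ i $ j)\<^sup>2)"
    unfolding matrix_mul_assoc[symmetric] by (rule frobenius_orthogonal_left[OF V])
  also have "\<dots> = (\<Sum>i\<in>UNIV. \<Sum>j\<in>UNIV. ((transpose V ** transpose M) $ i $ j)\<^sup>2)"
    by (subst tr[symmetric]) (simp add: matrix_transpose_mul)
  also have "\<dots> = (\<Sum>i\<in>UNIV. \<Sum>j\<in>UNIV. (M $ i $ j)\<^sup>2)"
    unfolding frobenius_orthogonal_left[OF V] by (rule tr)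
  finally show ?thesis .
qed

lemma joint_diag_objective_eq_offdiag:
  assumes "orthogonal_matrix V"
  shows "joint_diag_objective L M V =
    (\<Sum>l=1..L. \<Sum>i\<in>UNIV. \<Sum>j\<in>UNIV - {i}. ((transpose V ** M l ** V) $ i $ j)\<^sup>2)"
  by (simp add: joint_diag_objective_def matrix_inv_orthogonal[OF assms])

lemma joint_diag_objective_eq_diag:
  assumes "orthogonal_matrix V"
  shows "joint_diag_objective L M V =
    (\<Sum>l=1..L. \<Sum>i\<in>UNIV. \<Sum>j\<in>UNIV. (M l $ i $ j)\<^sup>2) -
    (\<Sum>l=1..L. \<Sum>i\<in>UNIV. ((transpose V ** M l ** V) $ i $ i)\<^sup>2)"
proof -
  have "(\<Sum>j\<in>UNIV - {i}. (X $ i $ j)\<^sup>2) = (\<Sum>j\<in>UNIV. (X $ i $ j)\<^sup>2) - (X $ i $ i)\<^sup>2"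
    for X :: "real^'a^'a" and i
    by (simp add: sum_diff1)
  then show ?thesis
    unfolding joint_diag_objective_eq_offdiag[OF assms]
    by (simp add: sum_subtractf frobenius_congruence[OF assms])
qed

section \<open>Consequences of minimality: stationarity under plane rotations and comparison with a
  competitor\<close>

definition rotate_columns :: "'n \<Rightarrow> 'n \<Rightarrow> real \<Rightarrow> real^'n^'m \<Rightarrow> real^'n^'m" where
  "rotate_columns p q \<theta> V = (\<chi> i k.
     if k = p then cos \<theta> * V $ i $ p + sin \<theta> * V $ i $ q
     else if k = q then cos \<theta> * V $ i $ q - sin \<theta> * V $ i $ p
     else V $ i $ k)"

lemma column_rotate_columns:
  "column k (rotate_columns p q \<theta> V) =
     (if k = p then cos \<theta> *\<^sub>R column p V + sin \<theta> *\<^sub>R column q V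
      else if k = q then cos \<theta> *\<^sub>R column q V - sin \<theta> *\<^sub>R column p V
      else column k V)"
  by (simp add: rotate_columns_def column_def vec_eq_iff)

lemma orthogonal_matrix_inner_columns:
  fixes V :: "real^'n^'n"
  shows "orthogonal_matrix V \<longleftrightarrow> (\<forall>i k. column i V \<bullet> column k V = (if i = k then 1 else 0))"
  by (simp add: orthogonal_matrix matrix_mult_transpose_dot_column vec_eq_iff mat_def)

lemma orthogonal_rotate_columns:
  fixes V :: "real^'n^'n"
  assumes "orthogonal_matrix V" "p \<noteq> q"
  shows "orthogonal_matrix (rotate_columns p q \<theta> V)"
proof -
  have "column i V \<bullet> column k V = (if i = k then 1 else 0)" for i k
    using assms(1) by (simp add: orthogonal_matrix_inner_columns)
  moreover have "cos \<theta> * cos \<theta> + sin \<theta> * sin \<theta> = 1" "sin \<theta> * sin \<theta> + cos \<theta> * cos \<theta> = 1"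
    using sin_cos_squared_add3[of \<theta>] by (simp_all only: add.commute)
  ultimately show ?thesis
    using assms(2)
    by (simp add: orthogonal_matrix_inner_columns column_rotate_columns inner_simps)
qed

lemma quadratic_form_combination:
  fixes M :: "real^'n^'n"
  shows "(a *\<^sub>R x + b *\<^sub>R y) \<bullet> (M *v (a *\<^sub>R x + b *\<^sub>R y)) =
    (x \<bullet> (M *v x)) * a\<^sup>2 + (x \<bullet> (M *v y) + y \<bullet> (M *v x)) * (a * b) + (y \<bullet> (M *v y)) * b\<^sup>2"
proof -
  have "M *v (a *\<^sub>R x + b *\<^sub>R y) = a *\<^sub>R (M *v x) + b *\<^sub>R (M *v y)"
    by (simp only: matrix_vector_right_distrib matrix_vector_mult_scaleR)
  then show ?thesis
    by (simp add: inner_add_left inner_add_right power2_eq_square distrib_left distrib_right mult_ac)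
qed

text \<open>Rotating columns \<open>p\<close> and \<open>q\<close> stays within the orthogonal
  matrices, so the sum of squared diagonal entries is maximal at angle 0 and its derivative there
  vanishes.\<close>

lemma orthogonal_minimizer_stationary:
  fixes M :: "nat \<Rightarrow> real^'n^'n"
  assumes min: "orthogonal_minimizer L M V"
    and sym: "\<And>l. l \<in> {1..L} \<Longrightarrow> transpose (M l) = M l"
    and "p \<noteq> q"
  defines "A \<equiv> \<lambda>l. transpose V ** M l ** V"
  shows "(\<Sum>l=1..L. A l $ p $ q * (A l $ p $ p - A l $ q $ q)) = 0"
proof -
  have orth: "orthogonal_matrix V"
    using min by (simp add: orthogonal_minimizer_def is_arg_min_def)
  define G where "G \<theta> = rotate_columns p q \<theta> V" for \<theta>
  define f where "f \<theta> = (\<Sum>l=1..L.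
      (A l $ p $ p * (cos \<theta>)\<^sup>2 + 2 * A l $ p $ q * (cos \<theta> * sin \<theta>) + A l $ q $ q * (sin \<theta>)\<^sup>2)\<^sup>2 +
      (A l $ p $ p * (sin \<theta>)\<^sup>2 - 2 * A l $ p $ q * (cos \<theta> * sin \<theta>) + A l $ q $ q * (cos \<theta>)\<^sup>2)\<^sup>2)"
    for \<theta>
  have A_sym: "A l $ q $ p = A l $ p $ q" if "l \<in> {1..L}" for l
  proof -
    have "transpose (A l) = A l"
      using sym[OF that] by (simp add: A_def matrix_transpose_mul matrix_mul_assoc)
    from arg_cong[OF this, of "\<lambda>X. X $ p $ q"] show ?thesis
      by (simp add: transpose_def[of "A l"])
  qed
  have Gp: "(transpose (G \<theta>) ** M l ** G \<theta>) $ p $ p =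
      A l $ p $ p * (cos \<theta>)\<^sup>2 + 2 * A l $ p $ q * (cos \<theta> * sin \<theta>) + A l $ q $ q * (sin \<theta>)\<^sup>2"
    and Gq: "(transpose (G \<theta>) ** M l ** G \<theta>) $ q $ q =
      A l $ p $ p * (sin \<theta>)\<^sup>2 - 2 * A l $ p $ q * (cos \<theta> * sin \<theta>) + A l $ q $ q * (cos \<theta>)\<^sup>2"
    if "l \<in> {1..L}" for l \<theta>
  proof -
    have sym': "column q V \<bullet> (M l *v column p V) = column p V \<bullet> (M l *v column q V)"
      using A_sym[OF that] by (simp add: A_def congruence_entry)
    show "(transpose (G \<theta>) ** M l ** G \<theta>) $ p $ p =
        A l $ p $ p * (cos \<theta>)\<^sup>2 + 2 * A l $ p $ q * (cos \<theta> * sin \<theta>) + A l $ q $ q * (sin \<theta>)\<^sup>2"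
      unfolding A_def congruence_entry G_def column_rotate_columns
      by (simp add: quadratic_form_combination sym')
    show "(transpose (G \<theta>) ** M l ** G \<theta>) $ q $ q =
        A l $ p $ p * (sin \<theta>)\<^sup>2 - 2 * A l $ p $ q * (cos \<theta> * sin \<theta>) + A l $ q $ q * (cos \<theta>)\<^sup>2"
      unfolding A_def congruence_entry G_def column_rotate_columns
      using \<open>p \<noteq> q\<close> quadratic_form_combination[of "- sin \<theta>" "column p V" "cos \<theta>" "column q V" "M l"]
      by (simp add: sym')
  qed
  have Gk: "(transpose (G \<theta>) ** M l ** G \<theta>) $ k $ k = A l $ k $ k" if "k \<noteq> p" "k \<noteq> q" for k l \<theta>
    using that unfolding A_def congruence_entry G_def by (simp add: column_rotate_columns)
  have diag: "(\<Sum>l=1..L. \<Sum>i\<in>UNIV. ((transpose (G \<theta>) ** M l ** G \<theta>) $ i $ i)\<^sup>2) =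
      f \<theta> + (\<Sum>l=1..L. \<Sum>i\<in>UNIV - {p, q}. (A l $ i $ i)\<^sup>2)" for \<theta>
  proof -
    have "(\<Sum>i\<in>UNIV. h i) = h p + h q + (\<Sum>i\<in>UNIV - {p, q}. h i)" for h :: "'n \<Rightarrow> real"
      using \<open>p \<noteq> q\<close> by (simp add: sum.remove[of UNIV p] sum.remove[of "UNIV - {p}" q]
          Diff_insert2[symmetric] insert_commute add.assoc)
    then show ?thesis
      unfolding f_def sum.distrib[symmetric] by (intro sum.cong) (auto simp: Gp Gq Gk)
  qed
  have "f \<theta> \<le> f 0" for \<theta>
  proof -
    have G0: "G 0 = V"
      by (simp add: G_def rotate_columns_def vec_eq_iff)
    have "orthogonal_matrix (G \<theta>)"
      unfolding G_def by (rule orthogonal_rotate_columns[OF orth \<open>p \<noteq> q\<close>])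
    moreover from this have "joint_diag_objective L M V \<le> joint_diag_objective L M (G \<theta>)"
      using min by (auto simp: orthogonal_minimizer_def is_arg_min_linorder)
    ultimately show ?thesis
      using diag[of \<theta>] diag[of 0] unfolding G0 by (simp add: joint_diag_objective_eq_diag orth)
  qed
  \<comment> \<open>At angle 0 the two inner quadratic forms equal \<open>A l $ p $ p\<close> and
    \<open>A l $ q $ q\<close>, with derivatives plus and minus
    \<open>2 * A l $ p $ q\<close>.\<close>
  moreover have "(f has_real_derivative
      (\<Sum>l=1..L. 4 * (A l $ p $ q * (A l $ p $ p - A l $ q $ q)))) (at 0)"
    unfolding f_def
    by (auto intro!: derivative_eq_intros sum.cong simp: algebra_simps)
  ultimately have "(\<Sum>l=1..L. 4 * (A l $ p $ q * (A l $ p $ p - A l $ q $ q))) = 0"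
    by (intro DERIV_local_max[of f _ 0 1]) auto
  then show ?thesis
    by (simp add: sum_distrib_left[symmetric])
qed

text \<open>A single squared entry is at most the objective at \<open>V\<close>, hence at most the
  objective at the competitor \<open>Q\<close>, where all off-diagonal entries are bounded by
  \<open>b\<close>.\<close>

lemma orthogonal_minimizer_offdiag_le:
  fixes M :: "nat \<Rightarrow> real^'n^'n"
  assumes min: "orthogonal_minimizer L M V"
    and Q: "orthogonal_matrix Q"
    and le: "\<And>l i k. l \<in> {1..L} \<Longrightarrow> i \<noteq> k \<Longrightarrow> \<bar>(transpose Q ** M l ** Q) $ i $ k\<bar> \<le> b"
    and "l \<in> {1..L}" "p \<noteq> q"
  shows "\<bar>(transpose V ** M l ** V) $ p $ q\<bar> \<le> b * (real L * real CARD('n))"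
proof -
  define A :: "real^'n^'n \<Rightarrow> nat \<Rightarrow> real^'n^'n" where "A X l = transpose X ** M l ** X" for X l
  have "0 \<le> b" using le[OF \<open>l \<in> {1..L}\<close> \<open>p \<noteq> q\<close>] by linarith
  have V: "orthogonal_matrix V"
    using min by (simp add: orthogonal_minimizer_def is_arg_min_def)
  have "(A V l $ p $ q)\<^sup>2 \<le> (\<Sum>j\<in>UNIV - {p}. (A V l $ p $ j)\<^sup>2)"
    using \<open>p \<noteq> q\<close> by (intro member_le_sum) auto
  also have "\<dots> \<le> (\<Sum>i\<in>UNIV. \<Sum>j\<in>UNIV - {i}. (A V l $ i $ j)\<^sup>2)"
    by (intro member_le_sum[where f="\<lambda>i. \<Sum>j\<in>UNIV - {i}. (A V l $ i $ j)\<^sup>2"]) (auto intro: sum_nonneg)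
  also have "\<dots> \<le> joint_diag_objective L M V"
    unfolding joint_diag_objective_eq_offdiag[OF V] A_def[symmetric] using \<open>l \<in> {1..L}\<close>
    by (intro member_le_sum[where f="\<lambda>l. \<Sum>i\<in>UNIV. \<Sum>j\<in>UNIV - {i}. (A V l $ i $ j)\<^sup>2"])
       (auto intro!: sum_nonneg)
  also have "\<dots> \<le> joint_diag_objective L M Q"
    using min Q by (auto simp: orthogonal_minimizer_def is_arg_min_linorder)
  also have "\<dots> \<le> (\<Sum>l=1..L. \<Sum>i\<in>(UNIV::'n set). \<Sum>j\<in>(UNIV::'n set). b\<^sup>2)"
    unfolding joint_diag_objective_eq_offdiag[OF Q]
  proof (intro sum_mono)
    fix l i assume l: "l \<in> {1..L}"
    have "(\<Sum>j\<in>UNIV - {i}. ((transpose Q ** M l ** Q) $ i $ j)\<^sup>2) \<le> (\<Sum>j\<in>UNIV - {i}. b\<^sup>2)"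
    proof (rule sum_mono)
      fix j assume "j \<in> UNIV - {i}"
      then show "((transpose Q ** M l ** Q) $ i $ j)\<^sup>2 \<le> b\<^sup>2"
        using power_mono[OF le[OF l, of i j], of 2] by auto
    qed
    also have "\<dots> \<le> (\<Sum>j\<in>(UNIV::'n set). b\<^sup>2)"
      by (intro sum_mono2) auto
    finally show "(\<Sum>j\<in>UNIV - {i}. ((transpose Q ** M l ** Q) $ i $ j)\<^sup>2) \<le> (\<Sum>j\<in>(UNIV::'n set). b\<^sup>2)" .
  qed
  also have "\<dots> = L * (CARD('n) * b)\<^sup>2"
    by (simp add: power2_eq_square)
  \<comment> \<open>Weakening \<open>L\<close> to its square gives a perfect square and avoids a
    root in the bound.\<close>
  also have "\<dots> \<le> L\<^sup>2 * (CARD('n) * b)\<^sup>2"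
  proof -
    have "1 \<le> L" using \<open>l \<in> {1..L}\<close> by simp
    then have "real L \<le> (real L)\<^sup>2" by (simp add: power2_eq_square)
    from mult_right_mono[OF this, of "(CARD('n) * b)\<^sup>2"] show ?thesis by simp
  qed
  also have "\<dots> = (b * (real L * real CARD('n)))\<^sup>2"
    by (simp add: power2_eq_square)
  finally have "(A V l $ p $ q)\<^sup>2 \<le> (b * (real L * real CARD('n)))\<^sup>2" .
  with \<open>0 \<le> b\<close> show ?thesis
    by (simp add: A_def abs_le_square_iff[symmetric])
qed

section \<open>Transfer to the basis \<open>Ubar\<close> and choice of uniform constants\<close>

lemma abs_congruence_entry_le_onorm:
  fixes Q X :: "real^'n^'n"
  assumes "orthogonal_matrix Q"
  shows "\<bar>(transpose Q ** X ** Q) $ i $ k\<bar> \<le> onorm ((*v) X)"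
proof -
  have unit: "norm (column m Q) = 1" for m
    using assms by (simp add: orthogonal_matrix_orthonormal_columns)
  have "\<bar>column i Q \<bullet> (X *v column k Q)\<bar> \<le> norm (column i Q) * norm (X *v column k Q)"
    by (rule Cauchy_Schwarz_ineq2)
  also have "\<dots> \<le> onorm ((*v) X)"
    using onorm[OF matrix_vector_mul_bounded_linear[of X], of "column k Q"] by (simp add: unit)
  finally show ?thesis by (simp add: congruence_entry)
qed

text \<open>By orthonormality, \<open>transpose Q ** U\<close> is the 0-1 matrix of the injection
  \<open>\<iota>\<close>. Conjugating with it places the diagonal of \<open>D\<close> at the
  positions in \<open>range \<iota>\<close> and fills the rest with zeros.\<close>

lemma congruence_factor:
  fixes U :: "real^'k^'d" and D :: "real^'k^'k" and Q :: "real^'d^'d"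
  assumes "orthogonal_matrix Q" "inj \<iota>" "\<And>a. column (\<iota> a) Q = column a U"
    and diag: "\<And>a b. a \<noteq> b \<Longrightarrow> D $ a $ b = 0"
  shows "transpose Q ** (U ** D ** transpose U) ** Q =
    (\<chi> i k. if i = k then (if i \<in> range \<iota> then D $ inv \<iota> i $ inv \<iota> i else 0) else 0)"
proof -
  define T where "T = transpose Q ** U"
  have T: "T $ i $ a = (if i = \<iota> a then 1 else 0)" for i a
  proof -
    have "T $ i $ a = column i Q \<bullet> column (\<iota> a) Q"
      unfolding T_def assms(3) by (simp add: matrix_mul_entry transpose_def inner_vec_def column_def)
    then show ?thesis
      using assms(1) by (simp add: orthogonal_matrix_inner_columns)
  qed
  have "transpose Q ** (U ** D ** transpose U) ** Q = T ** D ** transpose T"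
    by (simp add: T_def matrix_transpose_mul matrix_mul_assoc)
  moreover have "(T ** D ** transpose T) $ i $ k =
      (if i = k then (if i \<in> range \<iota> then D $ inv \<iota> i $ inv \<iota> i else 0) else 0)" for i k
  proof -
    have "(T ** D ** transpose T) $ i $ k =
        (\<Sum>b\<in>UNIV. (\<Sum>a\<in>UNIV. T $ i $ a * D $ a $ b) * T $ k $ b)"
      by (simp add: matrix_mul_entry transpose_def)
    also have "\<dots> = (\<Sum>b\<in>UNIV. (T $ i $ b * D $ b $ b) * T $ k $ b)"
    proof -
      have "(\<Sum>a\<in>UNIV. T $ i $ a * D $ a $ b) = T $ i $ b * D $ b $ b" for b
      proof -
        have "(\<Sum>a\<in>UNIV. T $ i $ a * D $ a $ b) =
            (\<Sum>a\<in>UNIV. if a = b then T $ i $ b * D $ b $ b else 0)"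
          by (intro sum.cong) (auto simp: diag)
        then show ?thesis by simp
      qed
      then show ?thesis by simp
    qed
    also have "\<dots> = (if i = k then (if i \<in> range \<iota> then D $ inv \<iota> i $ inv \<iota> i else 0) else 0)"
    proof (cases "i \<in> range \<iota>")
      case True
      then obtain a where a: "i = \<iota> a" by blast
      have "(\<Sum>b\<in>UNIV. (T $ i $ b * D $ b $ b) * T $ k $ b) =
          (\<Sum>b\<in>UNIV. if b = a then D $ a $ a * T $ k $ a else 0)"
        using assms(2) by (intro sum.cong) (auto simp: T a inj_eq)
      then show ?thesis
        using assms(2) by (auto simp: a T inj_eq)
    next
      case False
      then show ?thesis
        by (auto simp: T intro!: sum.neutral)
    qed
    finally show ?thesis .
  qed
  ultimately show ?thesis
    by (simp add: vec_eq_iff)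
qed

text \<open>A nonzero sum of squares has a nonzero term, and only finitely many differences occur,
  so their least nonzero modulus serves for all pairs.\<close>

lemma uniform_gap:
  fixes \<mu> :: "'d::finite \<Rightarrow> nat \<Rightarrow> real"
  assumes "\<And>i k. P i k \<Longrightarrow> (\<Sum>l=1..L. (\<mu> i l - \<mu> k l)\<^sup>2) \<noteq> 0"
  obtains c where "0 < c" "\<And>i k. P i k \<Longrightarrow> \<exists>l\<in>{1..L}. c \<le> \<bar>\<mu> i l - \<mu> k l\<bar>"
proof -
  define S where "S = (\<lambda>(i, k, l). \<bar>\<mu> i l - \<mu> k l\<bar>) ` (UNIV \<times> UNIV \<times> {1..L}) - {0}"
  \<comment> \<open>The extra element 1 keeps the minimum defined if no difference is
    nonzero.\<close>
  have fin: "finite (insert 1 S)" by (simp add: S_def)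
  show thesis
  proof
    show "0 < Min (insert 1 S)"
      using fin by (subst Min_gr_iff) (auto simp: S_def)
    fix i k assume "P i k"
    obtain l where l: "l \<in> {1..L}" "\<mu> i l - \<mu> k l \<noteq> 0"
    proof (rule ccontr)
      assume "\<not> thesis"
      with that have "\<mu> i l - \<mu> k l = 0" if "l \<in> {1..L}" for l using that by blast
      then have "(\<Sum>l=1..L. (\<mu> i l - \<mu> k l)\<^sup>2) = 0" by (intro sum.neutral) auto
      with assms[OF \<open>P i k\<close>] show False by simp
    qed
    then have "\<bar>\<mu> i l - \<mu> k l\<bar> \<in> insert 1 S"
      unfolding S_def by (auto intro!: image_eqI[of _ _ "(i, k, l)"])
    with l(1) fin show "\<exists>l\<in>{1..L}. Min (insert 1 S) \<le> \<bar>\<mu> i l - \<mu> k l\<bar>"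
      using Min_le by blast
  qed
qed

lemma scaled_square_smallo: "(\<lambda>\<epsilon>::real. C * \<epsilon>\<^sup>2) \<in> o[at_right 0](\<lambda>\<epsilon>. \<epsilon>)"
proof (rule smalloI_tendsto)
  have "((\<lambda>\<epsilon>. C * \<epsilon>) \<longlongrightarrow> 0) (at_right 0)"
    by (auto intro!: tendsto_eq_intros)
  moreover have "\<forall>\<^sub>F \<epsilon> in at_right 0. C * \<epsilon> = C * \<epsilon>\<^sup>2 / \<epsilon>"
    by (auto simp: eventually_at_filter power2_eq_square)
  ultimately show "((\<lambda>\<epsilon>. C * \<epsilon>\<^sup>2 / \<epsilon>) \<longlongrightarrow> 0) (at_right 0)"
    by (rule Lim_transform_eventually)
qed (auto simp: eventually_at_filter)

text \<open>The remainder \<open>\<rho>\<close> is chosen before \<open>\<epsilon>\<close>, the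
  perturbations, the extension and the minimizer, so the bound is uniform in them. The unit norm is
  read as the operator norm. The sign \<open>s\<close> reflects that the objective cannot
  distinguish a column from its negative, and the last assumption makes every denominator of
  \<open>E\<close> nonzero.\<close>

theorem lemma1:
  fixes U :: "real^'k^'d" and \<Lambda> :: "nat \<Rightarrow> real^'k^'k" and L :: nat and \<iota> :: "'k \<Rightarrow> 'd"
  assumes "L \<ge> 2"
    and "transpose U ** U = mat 1"
    and "\<And>l i j. l \<in> {1..L} \<Longrightarrow> i \<noteq> j \<Longrightarrow> \<Lambda> l $ i $ j = 0"
    and "inj \<iota>"
    and "\<And>i j. i \<noteq> \<iota> j \<Longrightarrow>
           (\<Sum>l=1..L. (factor_weight \<iota> \<Lambda> i l - factor_weight \<iota> \<Lambda> (\<iota> j) l)\<^sup>2) \<noteq> 0"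
  shows "\<exists>\<rho>::real \<Rightarrow> real. \<rho> \<in> o[at_right 0](\<lambda>\<epsilon>. \<epsilon>) \<and>
    (\<forall>\<epsilon>>0. \<forall>(R :: nat \<Rightarrow> real^'d^'d) (M :: nat \<Rightarrow> real^'d^'d) (Ubar :: real^'d^'d) (Util :: real^'d^'d).
       (\<forall>l\<in>{1..L}. onorm ((*v) (R l)) = 1 \<and>
                    M l = U ** \<Lambda> l ** transpose U + \<epsilon> *\<^sub>R R l \<and>
                    transpose (M l) = M l) \<and>
       orthogonal_matrix Ubar \<and> (\<forall>j. column (\<iota> j) Ubar = column j U) \<and>
       orthogonal_minimizer L M Util \<longrightarrow>
       (\<forall>j. \<exists>p. \<exists>s\<in>{-1, 1}.
          norm (s *\<^sub>R column p Util - column j U)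
            \<le> \<epsilon> * sqrt (\<Sum>i\<in>UNIV. (perturbation_matrix L \<iota> \<Lambda> R Ubar $ i $ j)\<^sup>2) + \<rho> \<epsilon>))"
proof -
  define \<mu> where "\<mu> = factor_weight \<iota> \<Lambda>"
  define n where "n = real CARD('d)"
  define B where "B = (\<Sum>l=1..L. \<Sum>i\<in>UNIV. \<bar>\<mu> i l\<bar>)"
  have \<mu>_le: "\<bar>\<mu> i l\<bar> \<le> B" if "l \<in> {1..L}" for i l
  proof -
    have "\<bar>\<mu> i l\<bar> \<le> (\<Sum>i\<in>UNIV. \<bar>\<mu> i l\<bar>)"
      by (rule member_le_sum) auto
    also have "\<dots> \<le> B"
      unfolding B_def using that
      by (intro member_le_sum[where f="\<lambda>l. \<Sum>i\<in>UNIV. \<bar>\<mu> i l\<bar>"]) (auto intro: sum_nonneg)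
    finally show ?thesis .
  qed
  have B_nonneg: "0 \<le> B"
    unfolding B_def by (intro sum_nonneg) auto
  obtain c where c: "0 < c"
    "\<And>i k. k \<in> range \<iota> \<and> i \<noteq> k \<Longrightarrow> \<exists>l\<in>{1..L}. c \<le> \<bar>\<mu> i l - \<mu> k l\<bar>"
    using uniform_gap[where P = "\<lambda>i k. k \<in> range \<iota> \<and> i \<noteq> k" and L = L and \<mu> = \<mu>] assms(5)
    unfolding \<mu>_def by blast
  \<comment> \<open>The locale constants can be named before any perturbation is fixed, because they
    take only \<open>L\<close>, \<open>B\<close>, \<open>c\<close> and \<open>n\<close> as
    parameters.\<close>
  define k2 where "k2 = near_diagonal.K2 L n"
  define k7 where "k7 = near_diagonal.K7 L B c n"
  \<comment> \<open>Below this threshold both \<open>\<epsilon> \<le> 1\<close> and the smallness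
    condition \<open>\<epsilon> * K2 \<le> c / 2\<close> hold; adding 1 keeps the quotient
    meaningful.\<close>
  define \<epsilon>0 where "\<epsilon>0 = min 1 (c / (2 * (\<bar>k2\<bar> + 1)))"
  have \<epsilon>0: "0 < \<epsilon>0" "\<epsilon>0 \<le> 1"
    using c(1) by (auto simp: \<epsilon>0_def)
  \<comment> \<open>The first summand serves small \<open>\<epsilon>\<close>; the second makes
    \<open>C * \<epsilon>\<^sup>2\<close> at least 2 beyond the threshold.\<close>
  define C where "C = \<bar>k7\<bar> + 2 / \<epsilon>0\<^sup>2"
  show ?thesis
  proof (intro exI[of _ "\<lambda>\<epsilon>. C * \<epsilon>\<^sup>2"] conjI scaled_square_smallo allI impI)
    fix \<epsilon> :: real and R M :: "nat \<Rightarrow> real^'d^'d" and Ubar Util :: "real^'d^'d" and j :: 'k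
    assume \<epsilon>: "0 < \<epsilon>"
    assume "(\<forall>l\<in>{1..L}. onorm ((*v) (R l)) = 1 \<and>
                    M l = U ** \<Lambda> l ** transpose U + \<epsilon> *\<^sub>R R l \<and>
                    transpose (M l) = M l) \<and>
       orthogonal_matrix Ubar \<and> (\<forall>j. column (\<iota> j) Ubar = column j U) \<and>
       orthogonal_minimizer L M Util"
    then have R: "\<And>l. l \<in> {1..L} \<Longrightarrow> onorm ((*v) (R l)) = 1"
      and M: "\<And>l. l \<in> {1..L} \<Longrightarrow> M l = U ** \<Lambda> l ** transpose U + \<epsilon> *\<^sub>R R l"
      and sym: "\<And>l. l \<in> {1..L} \<Longrightarrow> transpose (M l) = M l"
      and Ubar: "orthogonal_matrix Ubar" and col: "\<And>j. column (\<iota> j) Ubar = column j U"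
      and min: "orthogonal_minimizer L M Util"
      by blast+
    have Util: "orthogonal_matrix Util"
      using min by (simp add: orthogonal_minimizer_def is_arg_min_def)
    define R' where "R' l = transpose Ubar ** R l ** Ubar" for l
    define W where "W = transpose Ubar ** Util"
    define A where "A l = transpose Util ** M l ** Util" for l
    have Util_eq: "Util = Ubar ** W"
      using Ubar by (simp add: W_def matrix_mul_assoc orthogonal_matrix_def)
    have N: "transpose Ubar ** M l ** Ubar =
        (\<chi> i k. if i = k then \<mu> i l else 0) + \<epsilon> *\<^sub>R R' l" if "l \<in> {1..L}" for l
    proof -
      have "transpose Ubar ** M l ** Ubar =
          transpose Ubar ** (U ** \<Lambda> l ** transpose U) ** Ubar + \<epsilon> *\<^sub>R R' l"
        unfolding M[OF that] R'_def
        by (simp add: vec_eq_iff congruence_entry matrix_vector_mult_add_rdistrib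
            scaleR_matrix_vector_assoc[symmetric] inner_simps)
      also have "transpose Ubar ** (U ** \<Lambda> l ** transpose U) ** Ubar =
          (\<chi> i k. if i = k then \<mu> i l else 0)"
        unfolding \<mu>_def factor_weight_def
        by (rule congruence_factor[OF Ubar assms(4) col assms(3)[OF that]])
      finally show ?thesis .
    qed
    have R'_le: "\<bar>R' l $ i $ k\<bar> \<le> 1" if "l \<in> {1..L}" for l i k
      using abs_congruence_entry_le_onorm[OF Ubar, of "R l"] R[OF that] by (simp add: R'_def)
    show "\<exists>p. \<exists>s\<in>{-1, 1}. norm (s *\<^sub>R column p Util - column j U)
            \<le> \<epsilon> * sqrt (\<Sum>i\<in>UNIV. (perturbation_matrix L \<iota> \<Lambda> R Ubar $ i $ j)\<^sup>2) + C * \<epsilon>\<^sup>2"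
    proof (cases "\<epsilon> \<le> \<epsilon>0")
      case True
      interpret near_diagonal L \<mu> R' W A \<epsilon> B c n "\<iota> j"
      proof
        show "n = real CARD('d)" by (rule n_def)
        show "orthogonal_matrix W"
          unfolding W_def using Ubar Util by (intro orthogonal_matrix_mul) simp_all
        show "A l = transpose W ** ((\<chi> i k. if i = k then \<mu> i l else 0) + \<epsilon> *\<^sub>R R' l) ** W"
          if "l \<in> {1..L}" for l
          unfolding N[OF that, symmetric] A_def Util_eq
          by (simp add: matrix_transpose_mul matrix_mul_assoc)
        show "(\<Sum>l=1..L. A l $ p $ q * (A l $ p $ p - A l $ q $ q)) = 0" if "p \<noteq> q" for p q
          unfolding A_def by (rule orthogonal_minimizer_stationary[OF min sym that])
        show "\<bar>A l $ p $ q\<bar> \<le> \<epsilon> * (L * n)" if "l \<in> {1..L}" "p \<noteq> q" for l p q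
          unfolding A_def n_def
        \<comment> \<open>The competitor is \<open>Ubar\<close>, which diagonalizes the unperturbed
          matrices and leaves only \<open>\<epsilon> *\<^sub>R R' l\<close> off the
          diagonal.\<close>
        proof (rule orthogonal_minimizer_offdiag_le[OF min Ubar _ that])
          fix m :: nat and i k :: 'd assume "m \<in> {1..L}" "i \<noteq> k"
          then show "\<bar>(transpose Ubar ** M m ** Ubar) $ i $ k\<bar> \<le> \<epsilon>"
            using R'_le[of m i k] \<epsilon> by (simp add: N abs_mult)
        qed
      qed (use R'_le \<mu>_le B_nonneg \<epsilon> True \<epsilon>0 c in auto)
      have E_eq: "E i = perturbation_matrix L \<iota> \<Lambda> R Ubar $ i $ j" for i
        unfolding E_def by (simp add: perturbation_matrix_def \<mu>_def R'_def congruence_entry)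
      have small: "\<epsilon> * K2 \<le> c / 2"
      proof -
        have "\<epsilon> * K2 \<le> \<epsilon> * (\<bar>k2\<bar> + 1)"
          using \<epsilon> by (intro mult_left_mono) (auto simp: k2_def)
        also have "\<dots> \<le> c / (2 * (\<bar>k2\<bar> + 1)) * (\<bar>k2\<bar> + 1)"
          using True by (intro mult_right_mono) (auto simp: \<epsilon>0_def)
        also have "\<dots> = c / 2"
          by (simp add: field_simps)
        finally show ?thesis .
      qed
      obtain p where p: "1 / n \<le> \<bar>W $ \<iota> j $ p\<bar>"
        using ex_large_entry by blast
      define s where "s = sgn (W $ \<iota> j $ p)"
      have "s \<in> {-1, 1}"
        using p n_ge1 by (auto simp: s_def sgn_if)
      \<comment> \<open>\<open>Ubar\<close> is an isometry, so the estimate for \<open>W\<close>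
        carries over to \<open>Util\<close> unchanged.\<close>
      have "s *\<^sub>R column p Util - column j U = Ubar *v (s *\<^sub>R column p W - axis (\<iota> j) 1)"
      proof -
        have "column p Util = Ubar *v column p W"
          by (simp add: Util_eq column_def vec_eq_iff matrix_mul_entry matrix_vector_mult_def)
        moreover have "column j U = Ubar *v axis (\<iota> j) 1"
          by (simp add: col[symmetric] matrix_vector_mult_basis)
        ultimately show ?thesis
          by (simp only: matrix_vector_mult_diff_distrib matrix_vector_mult_scaleR)
      qed
      then have "norm (s *\<^sub>R column p Util - column j U) =
          norm (s *\<^sub>R column p W - axis (\<iota> j) 1)"
        by (simp add: norm_orthogonal_matrix_mult[OF Ubar])
      also have "\<dots> \<le> \<epsilon> * sqrt (\<Sum>i\<in>UNIV. (E i)\<^sup>2) + \<epsilon>\<^sup>2 * K7"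
        unfolding s_def by (rule column_le[OF p small])
      also have "\<epsilon>\<^sup>2 * K7 \<le> C * \<epsilon>\<^sup>2"
      proof -
        have "K7 \<le> C"
          unfolding C_def k7_def by (rule order_trans[OF abs_ge_self]) simp
        then show ?thesis
          using mult_left_mono[of K7 C "\<epsilon>\<^sup>2"] by (simp add: mult.commute)
      qed
      finally show ?thesis
        using \<open>s \<in> {-1, 1}\<close> by (intro exI[of _ p] bexI[of _ s]) (simp_all add: E_eq)
    next
      \<comment> \<open>For large \<open>\<epsilon>\<close> any column will do, since two unit
        vectors are at distance at most 2.\<close>
      case False
      fix p :: 'd
      have "norm (1 *\<^sub>R column p Util - column j U) \<le> norm (column p Util) + norm (column j U)"
        by (simp add: norm_triangle_ineq4)
      also have "\<dots> = 2"
        using Util Ubar by (simp add: orthogonal_matrix_orthonormal_columns col[symmetric])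
      also have "\<dots> \<le> C * \<epsilon>\<^sup>2"
      proof -
        have "2 = 2 / \<epsilon>0\<^sup>2 * \<epsilon>0\<^sup>2"
          using \<epsilon>0 by simp
        also have "\<dots> \<le> C * \<epsilon>\<^sup>2"
          using False \<epsilon>0 by (intro mult_mono power_mono) (auto simp: C_def)
        finally show ?thesis .
      qed
      finally have "norm (1 *\<^sub>R column p Util - column j U) \<le> C * \<epsilon>\<^sup>2" .
      moreover have "0 \<le> \<epsilon> * sqrt (\<Sum>i\<in>UNIV. (perturbation_matrix L \<iota> \<Lambda> R Ubar $ i $ j)\<^sup>2)"
        using \<epsilon> by (simp add: sum_nonneg)
      ultimately have "norm (1 *\<^sub>R column p Util - column j U) \<le>
          \<epsilon> * sqrt (\<Sum>i\<in>UNIV. (perturbation_matrix L \<iota> \<Lambda> R Ubar $ i $ j)\<^sup>2) + C * \<epsilon>\<^sup>2"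
        by linarith
      then show ?thesis
        by (intro exI[of _ p] bexI[of _ 1]) simp_all
    qed
  qed
qed

end
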